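(* Let $i\in\{1,\dots,M\}$ and $k\in\{1,\dots,q_i\}$, and let $c_j\in\mathbb{R}^{n_j}$ and $\alpha_j\ge0$ for $j\in\{1,\dots,M\}$. Denote by $G^k_{\mathcal{N}_i}$ the $k$-th row of $G_{\mathcal{N}_i}$ and by $g^k_{\mathcal{N}_i}$ the $k$-th element of $g_{\mathcal{N}_i}$. Suppose there exist scalars $\sigma^k_{ij}\ge0$, $j\in\mathcal{N}_i$, such that the symmetric block matrix $$ \begin{bmatrix} \sum_{j\in\mathcal{N}_i}\sigma_{ij}^kP_{ij} & \tfrac12\alpha_{\mathcal{N}_i}^{1/2}(G_{\mathcal{N}_i}^k)^\top\\ \tfrac12G_{\mathcal{N}_i}^k\alpha_{\mathcal{N}_i}^{1/2} & g_{\mathcal{N}_i}^k-G_{\mathcal{N}_i}^kc_{\mathcal{N}_i}-\sum_{j\in\mathcal{N}_i}\sigma_{ij}^k \end{bmatrix} $$ is positive semidefinite. Then the $k$-th state constraint $G^k_{\mathcal{N}_i}x_{\mathcal{N}_i}\le g^k_{\mathcal{N}_i}$ holds for every $x_{\mathcal{N}_i}\in\mathbb{R}^{n_{N_i}}$ whose components $x_j$, $j\in\mathcal{N}_i$, satisfy $(x_j-c_j)^\top P_j(x_j-c_j)\le\alpha_j$ for all $j\in\mathcal{N}_i$.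
   Context: A system is composed of $M$ subsystems; subsystem $j$ has state $x_j\in\mathbb{R}^{n_j}$. The global state is $x=[x_1^\top,\dots,x_M^\top]^\top\in\mathbb{R}^n$. For each $i$, $\mathcal{N}_i\subseteq\{1,\dots,M\}$ is the set of neighbors of subsystem $i$, with $i\in\mathcal{N}_i$, and $x_{\mathcal{N}_i}\in\mathbb{R}^{n_{N_i}}$ is the concatenation of the $x_j$, $j\in\mathcal{N}_i$ (so $n_{N_i}=\sum_{j\in\mathcal{N}_i}n_j$). $U_j\in\{0,1\}^{n_j\times n}$ and $W_{\mathcal{N}_i}\in\{0,1\}^{n_{N_i}\times n}$ are the selection matrices with $x_j=U_jx$ and $x_{\mathcal{N}_i}=W_{\mathcal{N}_i}x$. Symmetric positive definite matrices $P_j\in\mathbb{R}^{n_j\times n_j}$ are given; the terminal set of subsystem $j$ is the ellipsoid $\{x_j:(x_j-c_j)^\top P_j(x_j-c_j)\le\alpha_j\}$ with center $c_j$ and size $\alpha_j$. The state constraint set of subsystem $i$ is $\{x_{\mathcal{N}_i}\in\mathbb{R}^{n_{N_i}}:G_{\mathcal{N}_i}x_{\mathcal{N}_i}\le g_{\mathcal{N}_i}\}$ (componentwise inequality) with $G_{\mathcal{N}_i}\in\mathbb{R}^{q_i\times n_{N_i}}$, $g_{\mathcal{N}_i}\in\mathbb{R}^{q_i}$; it is assumed to contain the origin in its interior. Notation: $\alpha=\operatorname{diag}(\alpha_1I_{n_1},\dots,\alpha_MI_{n_M})$, $c=[c_1^\top,\dots,c_M^\top]^\top$, $\alpha_{\mathcal{N}_i}=W_{\mathcal{N}_i}\alpha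 W_{\mathcal{N}_i}^\top$ (diagonal, with entrywise square root $\alpha_{\mathcal{N}_i}^{1/2}$ on the diagonal), $c_{\mathcal{N}_i}=W_{\mathcal{N}_i}c$. For $j\in\mathcal{N}_i$, $P_{ij}=W_{\mathcal{N}_i}U_j^\top P_jU_jW_{\mathcal{N}_i}^\top$, i.e. the block-diagonal matrix with block $P_j$ at the position of $x_j$ in $x_{\mathcal{N}_i}$ and zeros elsewhere, so that $s_{\mathcal{N}_i}^\top P_{ij}s_{\mathcal{N}_i}=s_j^\top P_js_j$. *)

theory Defs
  imports Jordan_Normal_Form.Matrix
begin

text \<open>
  Subsystems are numbered \<open>0, ..., M - 1\<close> and rows of matrices start at \<open>0\<close>.
  Subsystem \<open>j\<close> has dimension \<open>n j\<close>; concatenations over a set of subsystems are taken in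
  increasing order of the subsystem number.
\<close>

definition stack_vecs :: "real vec list \<Rightarrow> real vec" where
  "stack_vecs vs = foldr (@\<^sub>v) vs vNil"

definition stack_mats :: "nat \<Rightarrow> real mat list \<Rightarrow> real mat" where
  "stack_mats nc As = foldr (@\<^sub>r) As (0\<^sub>m 0 nc)"

definition global_dim :: "(nat \<Rightarrow> nat) \<Rightarrow> nat \<Rightarrow> nat" where
  "global_dim n M = (\<Sum>j<M. n j)"

definition local_dim :: "(nat \<Rightarrow> nat) \<Rightarrow> nat set \<Rightarrow> nat" where
  "local_dim n S = (\<Sum>j\<in>S. n j)"

text \<open>
  \<open>sel_U n M j\<close> and \<open>sel_W n M S\<close> are the 0/1 selection matrices extracting from the global state
  the block of subsystem \<open>j\<close>, respectively the concatenation of the blocks in \<open>S\<close>;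
  see \<open>sel_U_mult\<close> and \<open>sel_W_mult\<close> below.
\<close>

definition sel_U :: "(nat \<Rightarrow> nat) \<Rightarrow> nat \<Rightarrow> nat \<Rightarrow> real mat" where
  "sel_U n M j =
     mat (n j) (global_dim n M) (\<lambda>(r, s). if s = (\<Sum>l<j. n l) + r then 1 else 0)"

definition sel_W :: "(nat \<Rightarrow> nat) \<Rightarrow> nat \<Rightarrow> nat set \<Rightarrow> real mat" where
  "sel_W n M S = stack_mats (global_dim n M) (map (sel_U n M) (sorted_list_of_set S))"

text \<open>The component of subsystem \<open>j\<close> in a vector that concatenates the blocks in \<open>S\<close>;
  see \<open>local_component_stack\<close> below.\<close>

definition local_component :: "(nat \<Rightarrow> nat) \<Rightarrow> nat \<Rightarrow> nat set \<Rightarrow> nat \<Rightarrow> real vec \<Rightarrow> real vec" where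
  "local_component n M S j y = (sel_U n M j * transpose_mat (sel_W n M S)) *\<^sub>v y"

definition local_center :: "(nat \<Rightarrow> nat) \<Rightarrow> nat \<Rightarrow> (nat \<Rightarrow> real vec) \<Rightarrow> nat set \<Rightarrow> real vec" where
  "local_center n M c S = sel_W n M S *\<^sub>v stack_vecs (map c [0..<M])"

definition size_mat :: "(nat \<Rightarrow> nat) \<Rightarrow> nat \<Rightarrow> (nat \<Rightarrow> real) \<Rightarrow> real mat" where
  "size_mat n M \<alpha> = diag_block_mat (map (\<lambda>j. \<alpha> j \<cdot>\<^sub>m 1\<^sub>m (n j)) [0..<M])"

definition local_size_mat :: "(nat \<Rightarrow> nat) \<Rightarrow> nat \<Rightarrow> (nat \<Rightarrow> real) \<Rightarrow> nat set \<Rightarrow> real mat" where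
  "local_size_mat n M \<alpha> S = sel_W n M S * size_mat n M \<alpha> * transpose_mat (sel_W n M S)"

text \<open>The entrywise square root is the matrix square root here, the matrix being diagonal.\<close>

definition local_size_sqrt :: "(nat \<Rightarrow> nat) \<Rightarrow> nat \<Rightarrow> (nat \<Rightarrow> real) \<Rightarrow> nat set \<Rightarrow> real mat" where
  "local_size_sqrt n M \<alpha> S = map_mat sqrt (local_size_mat n M \<alpha> S)"

text \<open>See \<open>local_P_quadratic_form\<close> below.\<close>

definition local_P :: "(nat \<Rightarrow> nat) \<Rightarrow> nat \<Rightarrow> (nat \<Rightarrow> real mat) \<Rightarrow> nat set \<Rightarrow> nat \<Rightarrow> real mat" where
  "local_P n M P S j =
     sel_W n M S * transpose_mat (sel_U n M j) * P j * sel_U n M j * transpose_mat (sel_W n M S)"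

definition weighted_P ::
  "(nat \<Rightarrow> nat) \<Rightarrow> nat \<Rightarrow> (nat \<Rightarrow> real mat) \<Rightarrow> nat set \<Rightarrow> (nat \<Rightarrow> real) \<Rightarrow> real mat" where
  "weighted_P n M P S \<sigma> =
     mat (local_dim n S) (local_dim n S) (\<lambda>rs. \<Sum>j\<in>S. (\<sigma> j \<cdot>\<^sub>m local_P n M P S j) $$ rs)"

text \<open>The parameters \<open>a\<close> and \<open>b\<close> stand for one constraint row and its right-hand side.\<close>

definition lmi_mat ::
  "(nat \<Rightarrow> nat) \<Rightarrow> nat \<Rightarrow> (nat \<Rightarrow> real mat) \<Rightarrow> (nat \<Rightarrow> real vec) \<Rightarrow> (nat \<Rightarrow> real)
     \<Rightarrow> nat set \<Rightarrow> real vec \<Rightarrow> real \<Rightarrow> (nat \<Rightarrow> real) \<Rightarrow> real mat" where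
  "lmi_mat n M P c \<alpha> S a b \<sigma> =
     (let R = local_size_sqrt n M \<alpha> S;
          A = mat_of_rows (local_dim n S) [a]
      in four_block_mat
           (weighted_P n M P S \<sigma>)
           ((1/2) \<cdot>\<^sub>m (R * transpose_mat A))
           ((1/2) \<cdot>\<^sub>m (A * R))
           (mat 1 1 (\<lambda>_. b - a \<bullet> local_center n M c S - (\<Sum>j\<in>S. \<sigma> j))))"

definition pos_def_mat :: "nat \<Rightarrow> real mat \<Rightarrow> bool" where
  "pos_def_mat m A \<longleftrightarrow> A \<in> carrier_mat m m \<and> transpose_mat A = A \<and>
     (\<forall>v \<in> carrier_vec m. v \<noteq> 0\<^sub>v m \<longrightarrow> 0 < v \<bullet> (A *\<^sub>v v))"

definition pos_semidef_mat :: "nat \<Rightarrow> real mat \<Rightarrow> bool" where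
  "pos_semidef_mat m A \<longleftrightarrow> A \<in> carrier_mat m m \<and> transpose_mat A = A \<and>
     (\<forall>v \<in> carrier_vec m. 0 \<le> v \<bullet> (A *\<^sub>v v))"

definition ellipsoid :: "nat \<Rightarrow> real mat \<Rightarrow> real vec \<Rightarrow> real \<Rightarrow> real vec set" where
  "ellipsoid m Q z a = {x \<in> carrier_vec m. (x - z) \<bullet> (Q *\<^sub>v (x - z)) \<le> a}"

definition polyhedron :: "nat \<Rightarrow> real mat \<Rightarrow> real vec \<Rightarrow> real vec set" where
  "polyhedron m A b = {x \<in> carrier_vec m. A *\<^sub>v x \<le> b}"

text \<open>Interior with respect to the Euclidean norm on \<open>carrier_vec m\<close>
  (the type of vectors of all dimensions carries no topology).\<close>

definition interior_vec :: "nat \<Rightarrow> real vec set \<Rightarrow> real vec set" where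
  "interior_vec m S = {x \<in> carrier_vec m.
     \<exists>\<epsilon>>0. \<forall>y \<in> carrier_vec m. sqrt ((y - x) \<bullet> (y - x)) < \<epsilon> \<longrightarrow> y \<in> S}"

lemma stack_vecs_simps [simp]:
  "stack_vecs [] = vNil"
  "stack_vecs (v # vs) = v @\<^sub>v stack_vecs vs"
  by (simp_all add: stack_vecs_def)

lemma stack_mats_simps [simp]:
  "stack_mats nc [] = 0\<^sub>m 0 nc"
  "stack_mats nc (A # As) = A @\<^sub>r stack_mats nc As"
  by (simp_all add: stack_mats_def)

lemma stack_vecs_append: "stack_vecs (vs @ ws) = stack_vecs vs @\<^sub>v stack_vecs ws"
  by (induction vs) (auto intro!: eq_vecI)

lemma dim_stack_map:
  assumes "\<And>j. j \<in> set js \<Longrightarrow> x j \<in> carrier_vec (n j)"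
  shows "stack_vecs (map x js) \<in> carrier_vec (\<Sum>j\<leftarrow>js. n j)"
  using assms by (induction js) auto

lemma stack_vecs_nth:
  assumes "\<And>j. j < M \<Longrightarrow> x j \<in> carrier_vec (n j)" and "j < M" and "r < n j"
  shows "stack_vecs (map x [0..<M]) $ ((\<Sum>l<j. n l) + r) = x j $ r"
  using assms
proof (induction M)
  case (Suc M)
  have "stack_vecs (map x [0..<M]) \<in> carrier_vec (\<Sum>j\<leftarrow>[0..<M]. n j)"
    by (rule dim_stack_map) (use Suc.prems in auto)
  then have d: "dim_vec (stack_vecs (map x [0..<M])) = (\<Sum>l<M. n l)"
    by (simp add: interv_sum_list_conv_sum_set_nat atLeast0LessThan)
  have dM: "dim_vec (x M) = n M" using Suc.prems(1) by auto
  show ?case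
  proof (cases "j = M")
    case True
    have "r < n M" using Suc.prems True by simp
    then show ?thesis using True dM by (simp add: stack_vecs_append d)
  next
    case False
    with Suc.prems have j: "j < M" by simp
    have "(\<Sum>l<j. n l) + r < (\<Sum>l<Suc j. n l)" using Suc.prems by simp
    also have "\<dots> \<le> (\<Sum>l<M. n l)" by (rule sum_mono2) (use j in auto)
    finally show ?thesis using Suc j dM by (simp add: stack_vecs_append d)
  qed
qed simp

lemma block_index_less:
  assumes "j < M" "r < n j"
  shows "(\<Sum>l<j. n l) + r < global_dim n M"
proof -
  have "(\<Sum>l<j. n l) + r < (\<Sum>l<Suc j. n l)" using assms by simp
  also have "\<dots> \<le> (\<Sum>l<M. n l)" by (rule sum_mono2) (use assms in auto)
  finally show ?thesis by (simp add: global_dim_def)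
qed

lemma sel_U_carrier [simp]: "sel_U n M j \<in> carrier_mat (n j) (global_dim n M)"
  by (simp add: sel_U_def)

lemma sel_U_mult_index:
  assumes "j < M" "r < n j" "v \<in> carrier_vec (global_dim n M)"
  shows "(sel_U n M j *\<^sub>v v) $ r = v $ ((\<Sum>l<j. n l) + r)"
proof -
  have "(sel_U n M j *\<^sub>v v) $ r
      = (\<Sum>s = 0..<global_dim n M. (if s = (\<Sum>l<j. n l) + r then 1 else 0) * v $ s)"
    using assms by (simp add: sel_U_def scalar_prod_def)
  also have "\<dots> = (\<Sum>s = 0..<global_dim n M. if s = (\<Sum>l<j. n l) + r then v $ s else 0)"
    by (intro sum.cong) auto
  finally have "(sel_U n M j *\<^sub>v v) $ r = \<dots>" .
  then show ?thesis using block_index_less[of j M r n] assms by simp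
qed

lemma sel_U_mult:
  assumes "\<And>j. j < M \<Longrightarrow> x j \<in> carrier_vec (n j)" and "j < M"
  shows "sel_U n M j *\<^sub>v stack_vecs (map x [0..<M]) = x j"
proof -
  have "stack_vecs (map x [0..<M]) \<in> carrier_vec (\<Sum>j\<leftarrow>[0..<M]. n j)"
    by (rule dim_stack_map) (use assms in auto)
  then have c: "stack_vecs (map x [0..<M]) \<in> carrier_vec (global_dim n M)"
    by (simp add: global_dim_def interv_sum_list_conv_sum_set_nat atLeast0LessThan)
  show ?thesis
    using assms(1)[OF assms(2)] sel_U_mult_index[OF assms(2) _ c]
      stack_vecs_nth[where x = x, OF assms(1) assms(2)]
    by (intro eq_vecI) (auto simp: sel_U_def)
qed

lemma stack_sel_U_carrier:
  "stack_mats (global_dim n M) (map (sel_U n M) js)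
     \<in> carrier_mat (\<Sum>j\<leftarrow>js. n j) (global_dim n M)"
  by (induction js) auto

lemma stack_sel_U_mult:
  assumes "v \<in> carrier_vec (global_dim n M)"
  shows "stack_mats (global_dim n M) (map (sel_U n M) js) *\<^sub>v v
    = stack_vecs (map (\<lambda>j. sel_U n M j *\<^sub>v v) js)"
proof (induction js)
  case (Cons j js)
  then show ?case using assms
    by (simp add: mat_mult_append[OF sel_U_carrier stack_sel_U_carrier])
qed (auto intro!: eq_vecI)

lemma sel_W_mult:
  assumes "\<And>j. j < M \<Longrightarrow> x j \<in> carrier_vec (n j)" and "S \<subseteq> {..<M}"
  shows "sel_W n M S *\<^sub>v stack_vecs (map x [0..<M]) = stack_vecs (map x (sorted_list_of_set S))"
proof -
  have "stack_vecs (map x [0..<M]) \<in> carrier_vec (\<Sum>j\<leftarrow>[0..<M]. n j)"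
    by (rule dim_stack_map) (use assms in auto)
  then have c: "stack_vecs (map x [0..<M]) \<in> carrier_vec (global_dim n M)"
    by (simp add: global_dim_def interv_sum_list_conv_sum_set_nat atLeast0LessThan)
  have "finite S" using assms(2) finite_subset by blast
  then show ?thesis unfolding sel_W_def stack_sel_U_mult[OF c]
    using assms by (intro arg_cong[of _ _ stack_vecs] map_cong refl sel_U_mult) auto
qed

lemma sel_W_carrier:
  assumes "finite S"
  shows "sel_W n M S \<in> carrier_mat (local_dim n S) (global_dim n M)"
  using stack_sel_U_carrier[of n M "sorted_list_of_set S"] assms
  by (simp add: sel_W_def local_dim_def sum_list_distinct_conv_sum_set)

lemma block_index_unique:
  fixes n :: "nat \<Rightarrow> nat"
  assumes "(\<Sum>l<i. n l) + r = (\<Sum>l<j. n l) + s" "r < n i" "s < n j"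
  shows "i = j"
proof -
  have *: "(\<Sum>l<i. n l) + r < (\<Sum>l<j. n l)" if "i < j" "r < n i" for i j r :: nat
    using block_index_less[of i j r n] that by (simp add: global_dim_def)
  show ?thesis using *[of i j r] *[of j i s] assms by (cases i j rule: linorder_cases) auto
qed

lemma sel_U_transpose_mult:
  assumes "i < M" "j < M" "v \<in> carrier_vec (n j)"
  shows "sel_U n M i *\<^sub>v (transpose_mat (sel_U n M j) *\<^sub>v v) = (if i = j then v else 0\<^sub>v (n i))"
proof (rule eq_vecI)
  have u: "transpose_mat (sel_U n M j) *\<^sub>v v \<in> carrier_vec (global_dim n M)"
    by (rule mult_mat_vec_carrier[OF _ assms(3)]) simp
  have "sel_U n M i *\<^sub>v (transpose_mat (sel_U n M j) *\<^sub>v v) \<in> carrier_vec (n i)"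
    by (rule mult_mat_vec_carrier[OF sel_U_carrier u])
  then show "dim_vec (sel_U n M i *\<^sub>v (transpose_mat (sel_U n M j) *\<^sub>v v))
      = dim_vec (if i = j then v else 0\<^sub>v (n i))"
    using assms by (auto simp: sel_U_def)
  fix r assume "r < dim_vec (if i = j then v else 0\<^sub>v (n i))"
  then have r: "r < n i" using assms by (auto split: if_splits)
  have "(sel_U n M i *\<^sub>v (transpose_mat (sel_U n M j) *\<^sub>v v)) $ r
      = (transpose_mat (sel_U n M j) *\<^sub>v v) $ ((\<Sum>l<i. n l) + r)"
    by (rule sel_U_mult_index[OF assms(1) r u])
  also have "\<dots> = (\<Sum>s = 0..<n j. if (\<Sum>l<i. n l) + r = (\<Sum>l<j. n l) + s then v $ s else 0)"
    using assms block_index_less[OF assms(1), of r n] r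
    by (auto simp: sel_U_def scalar_prod_def intro!: sum.cong)
  also have "\<dots> = (\<Sum>s = 0..<n j. if i = j \<and> s = r then v $ s else 0)"
    using block_index_unique[of n i r j] r by (intro sum.cong) auto
  also have "\<dots> = (if i = j then v else 0\<^sub>v (n i)) $ r"
    using r by auto
  finally show "(sel_U n M i *\<^sub>v (transpose_mat (sel_U n M j) *\<^sub>v v)) $ r
      = (if i = j then v else 0\<^sub>v (n i)) $ r" .
qed

lemma transpose_append_rows_mult:
  assumes "A \<in> carrier_mat r1 nc" "B \<in> carrier_mat r2 nc"
    and "a \<in> carrier_vec r1" "b \<in> carrier_vec r2"
  shows "transpose_mat (A @\<^sub>r B) *\<^sub>v (a @\<^sub>v b)
    = transpose_mat A *\<^sub>v a + transpose_mat B *\<^sub>v (b :: real vec)"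
proof (rule eq_vecI)
  fix s assume "s < dim_vec (transpose_mat A *\<^sub>v a + transpose_mat B *\<^sub>v b)"
  then have s: "s < nc" using assms by auto
  have "col (A @\<^sub>r B) s = col A s @\<^sub>v col B s"
    using assms s by (intro eq_vecI) (auto simp: append_rows_def)
  then show "(transpose_mat (A @\<^sub>r B) *\<^sub>v (a @\<^sub>v b)) $ s
      = (transpose_mat A *\<^sub>v a + transpose_mat B *\<^sub>v b) $ s"
    using assms s scalar_prod_append[of "col A s" r1 "col B s" r2 a b]
    by (auto simp: append_rows_def)
qed (use assms in \<open>auto simp: append_rows_def\<close>)

lemma local_component_stack:
  assumes "\<And>j. j \<in> S \<Longrightarrow> x j \<in> carrier_vec (n j)" and "S \<subseteq> {..<M}" and "j \<in> S"
  shows "local_component n M S j (stack_vecs (map x (sorted_list_of_set S))) = x j"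
proof -
  have fin: "finite S" using assms(2) finite_subset by blast
  have j: "j < M" using assms by auto
  have *: "sel_U n M j *\<^sub>v (transpose_mat (stack_mats (global_dim n M) (map (sel_U n M) js))
      *\<^sub>v stack_vecs (map x js)) = (if j \<in> set js then x j else 0\<^sub>v (n j))"
    if "distinct js" "set js \<subseteq> S" for js
    using that
  proof (induction js)
    case Nil
    have "transpose_mat (0\<^sub>m 0 (global_dim n M)) *\<^sub>v vNil = 0\<^sub>v (global_dim n M)"
      by (intro eq_vecI) (auto simp: scalar_prod_def)
    then show ?case by (auto intro!: eq_vecI simp: sel_U_def scalar_prod_def)
  next
    case (Cons l js)
    let ?W = "stack_mats (global_dim n M) (map (sel_U n M) js)"
    let ?y = "stack_vecs (map x js)"
    have l: "l < M" "x l \<in> carrier_vec (n l)" using Cons.prems assms by auto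
    have y: "?y \<in> carrier_vec (\<Sum>j\<leftarrow>js. n j)"
      by (rule dim_stack_map) (use Cons.prems assms(1) in auto)
    have W: "?W \<in> carrier_mat (\<Sum>j\<leftarrow>js. n j) (global_dim n M)"
      by (rule stack_sel_U_carrier)
    have "sel_U n M j *\<^sub>v (transpose_mat (sel_U n M l @\<^sub>r ?W) *\<^sub>v (x l @\<^sub>v ?y))
      = sel_U n M j *\<^sub>v (transpose_mat (sel_U n M l) *\<^sub>v x l)
        + sel_U n M j *\<^sub>v (transpose_mat ?W *\<^sub>v ?y)"
      unfolding transpose_append_rows_mult[OF sel_U_carrier W l(2) y]
      by (rule mult_add_distrib_mat_vec[OF sel_U_carrier])
        (use mult_mat_vec_carrier[OF transpose_carrier_mat[THEN iffD2, OF W] y]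
          mult_mat_vec_carrier[OF transpose_carrier_mat[THEN iffD2, OF sel_U_carrier[of n M l]] l(2)] in simp_all)
    then show ?case
      using Cons l assms(1)[OF assms(3)] by (auto simp: sel_U_transpose_mult[where n = n, OF j l])
  qed
  have y: "stack_vecs (map x (sorted_list_of_set S)) \<in> carrier_vec (local_dim n S)"
    using dim_stack_map[of "sorted_list_of_set S" x n] assms(1) fin
    by (simp add: local_dim_def sum_list_distinct_conv_sum_set)
  show ?thesis
    using *[of "sorted_list_of_set S"] fin assms(3)
    by (simp add: local_component_def sel_W_def[symmetric]
        assoc_mult_mat_vec[OF sel_U_carrier transpose_carrier_mat[THEN iffD2, OF sel_W_carrier[OF fin]] y])
qed

lemma local_P_quadratic_form:
  assumes "finite S" and P: "P j \<in> carrier_mat (n j) (n j)"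
    and y: "y \<in> carrier_vec (local_dim n S)"
  shows "y \<bullet> (local_P n M P S j *\<^sub>v y)
    = local_component n M S j y \<bullet> (P j *\<^sub>v local_component n M S j y)"
proof -
  let ?U = "sel_U n M j" and ?W = "sel_W n M S"
  let ?B = "?U * transpose_mat ?W"
  note U = sel_U_carrier[of n M j]
  note W = sel_W_carrier[OF assms(1), of n M]
  have Wt: "transpose_mat ?W \<in> carrier_mat (global_dim n M) (local_dim n S)" using W by simp
  have B: "?B \<in> carrier_mat (n j) (local_dim n S)" by (rule mult_carrier_mat[OF U Wt])
  then have Bt: "transpose_mat ?B \<in> carrier_mat (local_dim n S) (n j)" by simp
  have "transpose_mat ?B = ?W * transpose_mat ?U"
    using transpose_mult[OF U Wt] by simp
  then have "local_P n M P S j = transpose_mat ?B * P j * ?U * transpose_mat ?W"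
    by (simp add: local_P_def)
  also have "\<dots> = transpose_mat ?B * P j * ?B"
    by (rule assoc_mult_mat[OF mult_carrier_mat[OF Bt P] U Wt])
  finally have "local_P n M P S j *\<^sub>v y = transpose_mat ?B *\<^sub>v (P j *\<^sub>v (?B *\<^sub>v y))"
    using assoc_mult_mat_vec[OF mult_carrier_mat[OF Bt P] B y]
      assoc_mult_mat_vec[OF Bt P mult_mat_vec_carrier[OF B y]] by simp
  moreover have "y \<bullet> (transpose_mat ?B *\<^sub>v z) = (?B *\<^sub>v y) \<bullet> z" if z: "z \<in> carrier_vec (n j)" for z
    using transpose_vec_mult_scalar[OF B y z] Bt B y z
    by (metis comm_scalar_prod mult_mat_vec_carrier)
  ultimately show ?thesis
    using mult_mat_vec_carrier[OF P mult_mat_vec_carrier[OF B y]]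
    by (simp add: local_component_def)
qed

end

theory Submission
  imports Defs
begin

text \<open>
  S-procedure. Every point of the terminal ellipsoids can be written as
  \<open>x = c + \<alpha>\<^sup>1\<^sup>/\<^sup>2 s\<close>, blockwise with \<open>s\<^sub>j \<bullet> P\<^sub>j s\<^sub>j \<le> 1\<close>. The quadratic form of the
  matrix inequality at \<open>(s, -1)\<close> then reads
  \<open>0 \<le> (\<Sum>j. \<sigma>\<^sub>j (s\<^sub>j \<bullet> P\<^sub>j s\<^sub>j - 1)) + g - G c - G \<alpha>\<^sup>1\<^sup>/\<^sup>2 s \<le> g - G x\<close>.
\<close>

section \<open>Vectors as stacks of blocks\<close>

text \<open>Gives blockwise access to an arbitrary vector. The blocks are indexed by subsystem
  number, so a number occurring twice in \<open>js\<close> would force two segments of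
  \<open>v\<close> to coincide; hence \<open>distinct js\<close>.\<close>

lemma vec_eq_stack_vecs:
  assumes "distinct js" "v \<in> carrier_vec (\<Sum>j\<leftarrow>js. n j)"
  obtains x where "\<And>j. x j \<in> carrier_vec (n j)" "v = stack_vecs (map x js)"
proof -
  have "\<exists>x. (\<forall>j. x j \<in> carrier_vec (n j)) \<and> v = stack_vecs (map x js)"
    using assms
  proof (induction js arbitrary: v)
    case Nil
    \<comment> \<open>Blocks must have the right dimension for every number, also outside
      \<open>js\<close>; the zero vector is the default there.\<close>
    then show ?case by (intro exI[of _ "\<lambda>j. 0\<^sub>v (n j)"]) (auto intro!: eq_vecI)
  next
    case (Cons l js)
    let ?m = "\<Sum>j\<leftarrow>js. n j"
    have v: "v = vec_first v (n l) @\<^sub>v vec_last v ?m" using Cons.prems by simp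
    have "vec_last v ?m \<in> carrier_vec ?m" by simp
    then obtain x where x: "\<And>j. x j \<in> carrier_vec (n j)" "vec_last v ?m = stack_vecs (map x js)"
      using Cons by fastforce
    \<comment> \<open>By distinctness \<open>l\<close> does not occur in \<open>js\<close>, so
      setting the block at \<open>l\<close> leaves the blocks of the tail untouched.\<close>
    have "map (x(l := vec_first v (n l))) js = map x js" using Cons.prems by auto
    then have "stack_vecs (map (x(l := vec_first v (n l))) (l # js))
        = vec_first v (n l) @\<^sub>v stack_vecs (map x js)"
      by (simp only: list.map stack_vecs_simps fun_upd_same)
    then have "v = stack_vecs (map (x(l := vec_first v (n l))) (l # js))"
      using v x(2) by metis
    moreover have "\<forall>j. (x(l := vec_first v (n l))) j \<in> carrier_vec (n j)" using x by simp
    ultimately show ?case by blast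
  qed
  then show ?thesis using that by blast
qed

lemma stack_vecs_add:
  assumes "\<And>j. j \<in> set js \<Longrightarrow> x j \<in> carrier_vec (n j)" "\<And>j. j \<in> set js \<Longrightarrow> y j \<in> carrier_vec (n j)"
  shows "stack_vecs (map x js) + stack_vecs (map y js) = stack_vecs (map (\<lambda>j. x j + y j) js)"
  using assms
proof (induction js)
  case (Cons l js)
  then show ?case
    using append_vec_add[of "x l" "n l" "y l" "stack_vecs (map x js)" "\<Sum>j\<leftarrow>js. n j"
        "stack_vecs (map y js)"] dim_stack_map[of js x n] dim_stack_map[of js y n]
    by auto
qed (auto intro!: eq_vecI)

lemma smult_mat_mult_vec:
  assumes "A \<in> carrier_mat nr nc" "v \<in> carrier_vec nc"
  shows "(a \<cdot>\<^sub>m A) *\<^sub>v v = a \<cdot>\<^sub>v (A *\<^sub>v (v :: real vec))"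
  using assms by (intro eq_vecI) (auto simp: scalar_prod_def sum_distrib_left mult.assoc)

section \<open>Block-diagonal scalings\<close>

lemma diag_smult_carrier:
  "diag_block_mat (map (\<lambda>j. \<beta> j \<cdot>\<^sub>m 1\<^sub>m (n j)) js) \<in> carrier_mat (\<Sum>j\<leftarrow>js. n j) (\<Sum>j\<leftarrow>js. n j)"
  by (auto simp: dim_diag_block_mat o_def)

lemma diag_smult_mult_stack:
  fixes \<beta> :: "nat \<Rightarrow> real"
  assumes "\<And>j. j \<in> set js \<Longrightarrow> x j \<in> carrier_vec (n j)"
  shows "diag_block_mat (map (\<lambda>j. \<beta> j \<cdot>\<^sub>m 1\<^sub>m (n j)) js) *\<^sub>v stack_vecs (map x js)
    = stack_vecs (map (\<lambda>j. \<beta> j \<cdot>\<^sub>v x j) js)"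
  using assms
proof (induction js)
  case (Cons l js)
  let ?D = "diag_block_mat (map (\<lambda>j. \<beta> j \<cdot>\<^sub>m 1\<^sub>m (n j)) js)"
  have D: "?D \<in> carrier_mat (\<Sum>j\<leftarrow>js. n j) (\<Sum>j\<leftarrow>js. n j)" by (rule diag_smult_carrier)
  have "(\<beta> l \<cdot>\<^sub>m 1\<^sub>m (n l)) *\<^sub>v x l = \<beta> l \<cdot>\<^sub>v x l"
    using Cons.prems by (subst smult_mat_mult_vec[of _ "n l" "n l"]) auto
  \<comment> \<open>One unfolding of \<open>diag_block_mat\<close> yields this four-block matrix;
    its zero off-diagonal blocks make it act on head and tail separately.\<close>
  moreover have "four_block_mat (\<beta> l \<cdot>\<^sub>m 1\<^sub>m (n l)) (0\<^sub>m (n l) (\<Sum>j\<leftarrow>js. n j)) (0\<^sub>m (\<Sum>j\<leftarrow>js. n j) (n l)) ?D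
      *\<^sub>v (x l @\<^sub>v stack_vecs (map x js))
    = (\<beta> l \<cdot>\<^sub>m 1\<^sub>m (n l)) *\<^sub>v x l @\<^sub>v ?D *\<^sub>v stack_vecs (map x js)"
    by (rule mult_mat_vec_split[OF _ D]) (use Cons.prems dim_stack_map[of js x n] in auto)
  ultimately show ?case using Cons D by (simp add: Let_def)
qed (auto intro!: eq_vecI)

lemma diag_smult_symmetric:
  "transpose_mat (diag_block_mat (map (\<lambda>j. \<beta> j \<cdot>\<^sub>m 1\<^sub>m (n j)) js))
    = diag_block_mat (map (\<lambda>j. \<beta> j \<cdot>\<^sub>m 1\<^sub>m (n j)) js)"
proof (induction js)
  case (Cons l js)
  have D: "diag_block_mat (map (\<lambda>j. \<beta> j \<cdot>\<^sub>m 1\<^sub>m (n j)) js) \<in> carrier_mat (\<Sum>j\<leftarrow>js. n j) (\<Sum>j\<leftarrow>js. n j)"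
    by (rule diag_smult_carrier)
  have "transpose_mat (\<beta> l \<cdot>\<^sub>m 1\<^sub>m (n l)) = \<beta> l \<cdot>\<^sub>m 1\<^sub>m (n l)" by (auto intro!: eq_matI)
  then show ?case using Cons D
    by (simp add: Let_def transpose_four_block_mat[of _ "n l" "n l" _ "\<Sum>j\<leftarrow>js. n j" _ "\<Sum>j\<leftarrow>js. n j"])
qed auto

text \<open>The entrywise root preserves the block-diagonal shape because \<open>sqrt 0 = 0\<close>,
  both outside the blocks and off the diagonal inside a block.\<close>

lemma map_mat_sqrt_diag_smult:
  "map_mat sqrt (diag_block_mat (map (\<lambda>j. \<beta> j \<cdot>\<^sub>m 1\<^sub>m (n j)) js))
    = diag_block_mat (map (\<lambda>j. sqrt (\<beta> j) \<cdot>\<^sub>m 1\<^sub>m (n j)) js)"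
proof (induction js)
  case (Cons l js)
  have D: "diag_block_mat (map (\<lambda>j. \<gamma> j \<cdot>\<^sub>m 1\<^sub>m (n j)) js) \<in> carrier_mat (\<Sum>j\<leftarrow>js. n j) (\<Sum>j\<leftarrow>js. n j)"
    for \<gamma> :: "_ \<Rightarrow> real" by (rule diag_smult_carrier)
  have "map_mat sqrt (\<beta> l \<cdot>\<^sub>m 1\<^sub>m (n l)) = sqrt (\<beta> l) \<cdot>\<^sub>m 1\<^sub>m (n l)" by (auto intro!: eq_matI)
  moreover have "map_mat sqrt (0\<^sub>m u v) = 0\<^sub>m u v" for u v by (auto intro!: eq_matI)
  ultimately show ?case using Cons D[of \<beta>] D[of "\<lambda>j. sqrt (\<beta> j)"]
    by (simp add: Let_def map_four_block_mat[of _ "n l" "n l" _ "\<Sum>j\<leftarrow>js. n j" _ "\<Sum>j\<leftarrow>js. n j"])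
qed auto

lemma size_mat_carrier: "size_mat n M \<alpha> \<in> carrier_mat (global_dim n M) (global_dim n M)"
  using diag_smult_carrier[of \<alpha> n "[0..<M]"]
  by (simp add: size_mat_def global_dim_def interv_sum_list_conv_sum_set_nat atLeast0LessThan)

section \<open>Selection matrices and the root of the local size matrix\<close>

text \<open>Row \<open>r\<close> of \<open>W\<close> is the unit vector at \<open>f r\<close>, so
  conjugation by \<open>W\<close> forms no sums of entries: it only copies them. This is what lets
  an entrywise function pass through the conjugation.\<close>

lemma selection_mat_conj:
  fixes D :: "real mat"
  assumes f: "\<And>r. r < m \<Longrightarrow> f r < d" and D: "D \<in> carrier_mat d d"
    and W: "W = mat m d (\<lambda>(r, s). if s = f r then 1 else 0)"
  shows "W * D * transpose_mat W = mat m m (\<lambda>(r, s). D $$ (f r, f s))"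
proof -
  have row: "row W r = unit_vec d (f r)" if "r < m" for r
    using that f by (auto simp: W intro!: eq_vecI)
  have "(W * D) = mat m d (\<lambda>(r, s). D $$ (f r, s))"
    using D f row by (intro eq_matI) (auto simp: W)
  then show ?thesis
    using D f row by (intro eq_matI) (auto simp: W)
qed

text \<open>Brings \<open>sel_W\<close> into the shape that \<open>selection_mat_conj\<close>
  requires; \<open>f\<close> sends a local row index to the global coordinate it reads.\<close>

lemma stack_sel_U_selection:
  assumes "set js \<subseteq> {..<M}"
  obtains f where "\<And>r. r < (\<Sum>j\<leftarrow>js. n j) \<Longrightarrow> f r < global_dim n M"
    "stack_mats (global_dim n M) (map (sel_U n M) js)
      = mat (\<Sum>j\<leftarrow>js. n j) (global_dim n M) (\<lambda>(r, s). if s = f r then 1 else 0)"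
proof -
  have "\<exists>f. (\<forall>r < \<Sum>j\<leftarrow>js. n j. f r < global_dim n M) \<and>
    stack_mats (global_dim n M) (map (sel_U n M) js)
      = mat (\<Sum>j\<leftarrow>js. n j) (global_dim n M) (\<lambda>(r, s). if s = f r then 1 else 0)"
    using assms
  proof (induction js)
    case Nil
    then show ?case by (auto intro!: eq_matI)
  next
    case (Cons l js)
    then obtain f where f: "\<forall>r < \<Sum>j\<leftarrow>js. n j. f r < global_dim n M"
      and W: "stack_mats (global_dim n M) (map (sel_U n M) js)
        = mat (\<Sum>j\<leftarrow>js. n j) (global_dim n M) (\<lambda>(r, s). if s = f r then 1 else 0)"
      by auto
    \<comment> \<open>The first \<open>n l\<close> rows read block \<open>l\<close>, which starts at
      the global offset \<open>\<Sum>j<l. n j\<close>; later rows are those of the tail, with the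
      index shifted back by \<open>n l\<close>.\<close>
    let ?f = "\<lambda>r. if r < n l then (\<Sum>j<l. n j) + r else f (r - n l)"
    have "\<forall>r < \<Sum>j\<leftarrow>l # js. n j. ?f r < global_dim n M"
      using f Cons.prems block_index_less[of l M _ n] by auto
    moreover have "stack_mats (global_dim n M) (map (sel_U n M) (l # js))
        = mat (\<Sum>j\<leftarrow>l # js. n j) (global_dim n M) (\<lambda>(r, s). if s = ?f r then 1 else 0)"
      by (intro eq_matI) (simp_all add: W append_rows_def sel_U_def)
    ultimately show ?case by (intro exI[of _ ?f] conjI)
  qed
  then show ?thesis using that by blast
qed

text \<open>Both sides copy entries of a size matrix along the same \<open>f\<close>, and the root
  of the size matrix for \<alpha> is the size matrix for the roots. Carrier, symmetry and action of
  \<open>local_size_sqrt\<close> thus reduce to those of \<open>local_size_mat\<close>.\<close>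

lemma local_size_sqrt_eq:
  assumes "S \<subseteq> {..<M}"
  shows "local_size_sqrt n M \<alpha> S = local_size_mat n M (\<lambda>j. sqrt (\<alpha> j)) S"
proof -
  have fin: "finite S" using assms finite_subset by blast
  obtain f where f: "\<And>r. r < (\<Sum>j\<leftarrow>sorted_list_of_set S. n j) \<Longrightarrow> f r < global_dim n M"
    "sel_W n M S = mat (\<Sum>j\<leftarrow>sorted_list_of_set S. n j) (global_dim n M) (\<lambda>(r, s). if s = f r then 1 else 0)"
    using stack_sel_U_selection[of "sorted_list_of_set S" M n] assms fin by (auto simp: sel_W_def)
  have D: "size_mat n M (\<lambda>j. sqrt (\<alpha> j)) = map_mat sqrt (size_mat n M \<alpha>)"
    by (simp add: size_mat_def map_mat_sqrt_diag_smult)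
  have WDW: "sel_W n M S * size_mat n M \<beta> * transpose_mat (sel_W n M S)
      = mat (\<Sum>j\<leftarrow>sorted_list_of_set S. n j) (\<Sum>j\<leftarrow>sorted_list_of_set S. n j)
          (\<lambda>(r, s). size_mat n M \<beta> $$ (f r, f s))" for \<beta>
    by (rule selection_mat_conj[OF f(1) size_mat_carrier f(2)])
  show ?thesis
    unfolding local_size_sqrt_def local_size_mat_def WDW
    using f(1) size_mat_carrier[of n M \<alpha>] by (intro eq_matI) (auto simp: D)
qed

lemma local_size_mat_carrier:
  assumes "finite S"
  shows "local_size_mat n M \<alpha> S \<in> carrier_mat (local_dim n S) (local_dim n S)"
  using sel_W_carrier[OF assms, of n M] size_mat_carrier[of n M \<alpha>]
  by (auto simp: local_size_mat_def)

text \<open>Conjugation by \<open>W\<close> preserves the symmetry of the diagonal size matrix.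
  Symmetry later makes the two off-diagonal blocks of the matrix inequality contribute
  equally.\<close>

lemma local_size_mat_symmetric:
  assumes "finite S"
  shows "transpose_mat (local_size_mat n M \<alpha> S) = local_size_mat n M \<alpha> S"
proof -
  note W = sel_W_carrier[OF assms, of n M] and D = size_mat_carrier[of n M \<alpha>]
  have Wt: "transpose_mat (sel_W n M S) \<in> carrier_mat (global_dim n M) (local_dim n S)"
    using W by simp
  have "transpose_mat (size_mat n M \<alpha>) = size_mat n M \<alpha>"
    by (simp add: size_mat_def diag_smult_symmetric)
  then show ?thesis
    using transpose_mult[OF mult_carrier_mat[OF W D] Wt] transpose_mult[OF W D]
      assoc_mult_mat[OF W D Wt] by (simp add: local_size_mat_def)
qed

text \<open>The three factors act in turn: the transpose of \<open>W\<close> places the blocks in a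
  global vector, the size matrix scales each block by its own factor, and \<open>W\<close> reads the
  blocks of \<open>S\<close> back.\<close>

lemma local_size_mat_mult_stack:
  assumes "S \<subseteq> {..<M}" and x: "\<And>j. j \<in> S \<Longrightarrow> x j \<in> carrier_vec (n j)"
  shows "local_size_mat n M \<beta> S *\<^sub>v stack_vecs (map x (sorted_list_of_set S))
    = stack_vecs (map (\<lambda>j. \<beta> j \<cdot>\<^sub>v x j) (sorted_list_of_set S))"
proof -
  have fin: "finite S" using assms(1) finite_subset by blast
  note W = sel_W_carrier[OF fin, of n M] and D = size_mat_carrier[of n M \<beta>]
  have Wt: "transpose_mat (sel_W n M S) \<in> carrier_mat (global_dim n M) (local_dim n S)"
    using W by simp
  let ?v = "stack_vecs (map x (sorted_list_of_set S))"
  have v: "?v \<in> carrier_vec (local_dim n S)"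
    using dim_stack_map[of "sorted_list_of_set S" x n] x fin
    by (simp add: local_dim_def sum_list_distinct_conv_sum_set)
  let ?u = "transpose_mat (sel_W n M S) *\<^sub>v ?v"
  have u: "?u \<in> carrier_vec (global_dim n M)" by (rule mult_mat_vec_carrier[OF Wt v])
  then obtain y where y: "\<And>j. y j \<in> carrier_vec (n j)" "?u = stack_vecs (map y [0..<M])"
    using vec_eq_stack_vecs[of "[0..<M]" ?u n]
    by (auto simp: global_dim_def interv_sum_list_conv_sum_set_nat atLeast0LessThan)
  \<comment> \<open>Block \<open>j\<close> of the global vector is read off in two ways, by
    \<open>local_component_stack\<close> and by \<open>sel_U_mult\<close>. Blocks outside
    \<open>S\<close> can stay unidentified, since \<open>W\<close> discards them.\<close>
  have xy: "y j = x j" if "j \<in> S" for j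
  proof -
    have "x j = sel_U n M j *\<^sub>v ?u"
      using local_component_stack[where n = n, OF x assms(1) that]
        assoc_mult_mat_vec[OF sel_U_carrier Wt v]
      by (simp add: local_component_def)
    also have "\<dots> = y j" using sel_U_mult[of M y n j] y assms(1) that by auto
    finally show ?thesis by simp
  qed
  have "local_size_mat n M \<beta> S *\<^sub>v ?v = sel_W n M S *\<^sub>v (size_mat n M \<beta> *\<^sub>v ?u)"
    using assoc_mult_mat_vec[OF mult_carrier_mat[OF W D] Wt v] assoc_mult_mat_vec[OF W D u]
    by (simp add: local_size_mat_def)
  also have "size_mat n M \<beta> *\<^sub>v ?u = stack_vecs (map (\<lambda>j. \<beta> j \<cdot>\<^sub>v y j) [0..<M])"
    unfolding y(2) size_mat_def by (rule diag_smult_mult_stack) (rule y(1))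
  also have "sel_W n M S *\<^sub>v \<dots> = stack_vecs (map (\<lambda>j. \<beta> j \<cdot>\<^sub>v y j) (sorted_list_of_set S))"
    by (rule sel_W_mult) (use y assms in auto)
  also have "map (\<lambda>j. \<beta> j \<cdot>\<^sub>v y j) (sorted_list_of_set S) = map (\<lambda>j. \<beta> j \<cdot>\<^sub>v x j) (sorted_list_of_set S)"
    using xy fin by simp
  finally show ?thesis .
qed

section \<open>Quadratic form of the matrix inequality\<close>

text \<open>\<open>weighted_P\<close> is an entrywise sum, so its form is expanded over pairs of
  coordinates and the sum over \<open>S\<close> is moved outermost; each summand is then a form of
  \<open>local_P\<close>.\<close>

lemma weighted_P_quadratic_form:
  assumes fin: "finite S" and P: "\<And>j. j \<in> S \<Longrightarrow> P j \<in> carrier_mat (n j) (n j)"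
    and y: "y \<in> carrier_vec (local_dim n S)"
  shows "y \<bullet> (weighted_P n M P S \<sigma> *\<^sub>v y)
    = (\<Sum>j\<in>S. \<sigma> j * (local_component n M S j y \<bullet> (P j *\<^sub>v local_component n M S j y)))"
proof -
  let ?m = "local_dim n S" and ?L = "local_P n M P S"
  \<comment> \<open>Stated for a general \<open>A\<close>, to expand the form of
    \<open>weighted_P\<close> and to fold the form of each \<open>local_P\<close> back.\<close>
  have qf: "y \<bullet> (A *\<^sub>v y) = (\<Sum>r<?m. \<Sum>s<?m. y $ r * (A $$ (r, s) * y $ s))"
    if "A \<in> carrier_mat ?m ?m" for A
    using that y by (simp add: scalar_prod_def sum_distrib_left atLeast0LessThan)
  have L: "?L j \<in> carrier_mat ?m ?m" if "j \<in> S" for j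
    using sel_W_carrier[OF fin, of n M] P[OF that] by (auto simp: local_P_def)
  have "y \<bullet> (weighted_P n M P S \<sigma> *\<^sub>v y)
    = (\<Sum>r<?m. \<Sum>s<?m. \<Sum>j\<in>S. \<sigma> j * (y $ r * (?L j $$ (r, s) * y $ s)))"
    using carrier_matD[OF L]
    by (subst qf) (auto simp: weighted_P_def sum_distrib_left sum_distrib_right algebra_simps
        intro!: sum.cong)
  also have "\<dots> = (\<Sum>r<?m. \<Sum>j\<in>S. \<Sum>s<?m. \<sigma> j * (y $ r * (?L j $$ (r, s) * y $ s)))"
    by (intro sum.cong refl sum.swap)
  also have "\<dots> = (\<Sum>j\<in>S. \<Sum>r<?m. \<Sum>s<?m. \<sigma> j * (y $ r * (?L j $$ (r, s) * y $ s)))"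
    by (rule sum.swap)
  also have "\<dots> = (\<Sum>j\<in>S. \<sigma> j * (y \<bullet> (?L j *\<^sub>v y)))"
    by (simp add: qf[OF L] sum_distrib_left)
  also have "\<dots> = (\<Sum>j\<in>S. \<sigma> j * (local_component n M S j y \<bullet> (P j *\<^sub>v local_component n M S j y)))"
    by (intro sum.cong refl) (simp add: local_P_quadratic_form[where n = n and P = P, OF fin P y])
  finally show ?thesis .
qed

text \<open>Splitting along the four blocks leaves the weighted form, the corner entry times
  \<open>t\<^sup>2\<close>, and two cross terms. Each cross term is half of
  \<open>t * (a \<bullet> (R *\<^sub>v y))\<close>, where \<open>R\<close> is the local
  root.\<close>

lemma lmi_mat_quadratic_form:
  assumes S: "S \<subseteq> {..<M}" and P: "\<And>j. j \<in> S \<Longrightarrow> P j \<in> carrier_mat (n j) (n j)"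
    and a: "a \<in> carrier_vec (local_dim n S)" and y: "y \<in> carrier_vec (local_dim n S)"
  shows "(y @\<^sub>v vec 1 (\<lambda>_. t)) \<bullet> (lmi_mat n M P c \<alpha> S a b \<sigma> *\<^sub>v (y @\<^sub>v vec 1 (\<lambda>_. t)))
    = (\<Sum>j\<in>S. \<sigma> j * (local_component n M S j y \<bullet> (P j *\<^sub>v local_component n M S j y)))
      + t * (a \<bullet> (local_size_sqrt n M \<alpha> S *\<^sub>v y))
      + t\<^sup>2 * (b - a \<bullet> local_center n M c S - (\<Sum>j\<in>S. \<sigma> j))"
proof -
  have fin: "finite S" using S finite_subset by blast
  let ?m = "local_dim n S" and ?Q = "weighted_P n M P S \<sigma>"
  let ?R = "local_size_sqrt n M \<alpha> S" and ?A = "mat_of_rows (local_dim n S) [a]"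
  let ?d = "b - a \<bullet> local_center n M c S - (\<Sum>j\<in>S. \<sigma> j)"
  let ?e = "vec 1 (\<lambda>_. t)"
  have R: "?R \<in> carrier_mat ?m ?m" and Rt: "transpose_mat ?R = ?R"
    using local_size_mat_carrier[OF fin] local_size_mat_symmetric[OF fin]
    by (simp_all add: local_size_sqrt_eq[OF S])
  have Q: "?Q \<in> carrier_mat ?m ?m" by (simp add: weighted_P_def)
  have A: "?A \<in> carrier_mat 1 ?m" and At: "transpose_mat ?A \<in> carrier_mat ?m 1"
    using mat_of_rows_carrier(1)[of ?m "[a]"] by simp_all
  have e: "?e \<in> carrier_vec 1" by simp
  have Ry: "?R *\<^sub>v y \<in> carrier_vec ?m" by (rule mult_mat_vec_carrier[OF R y])
  have Ate: "transpose_mat ?A *\<^sub>v ?e = t \<cdot>\<^sub>v a"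
    using a by (intro eq_vecI) (auto simp: mat_of_rows_def scalar_prod_def)
  \<comment> \<open>Symmetry of \<open>?R\<close> moves it from \<open>a\<close> to
    \<open>y\<close>, so that the upper right block gives the same value as the lower left
    one.\<close>
  have "y \<bullet> (?R *\<^sub>v (t \<cdot>\<^sub>v a)) = t * (a \<bullet> (?R *\<^sub>v y))"
    using transpose_vec_mult_scalar[OF R y, of "t \<cdot>\<^sub>v a"] a y R Rt Ry
      comm_scalar_prod[OF y mult_mat_vec_carrier[OF R], of "t \<cdot>\<^sub>v a"]
    by simp
  moreover have "((1/2) \<cdot>\<^sub>m (?R * transpose_mat ?A)) *\<^sub>v ?e = (1/2) \<cdot>\<^sub>v (?R *\<^sub>v (t \<cdot>\<^sub>v a))"
    using smult_mat_mult_vec[OF mult_carrier_mat[OF R At] e]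
      assoc_mult_mat_vec[OF R At e] Ate by simp
  ultimately have B: "y \<bullet> (((1/2) \<cdot>\<^sub>m (?R * transpose_mat ?A)) *\<^sub>v ?e) = t / 2 * (a \<bullet> (?R *\<^sub>v y))"
    using y a R by simp
  have "((1/2) \<cdot>\<^sub>m (?A * ?R)) *\<^sub>v y = (1/2) \<cdot>\<^sub>v (?A *\<^sub>v (?R *\<^sub>v y))"
    using smult_mat_mult_vec[OF mult_carrier_mat[OF A R] y]
      assoc_mult_mat_vec[OF A R y] by simp
  also have "?A *\<^sub>v (?R *\<^sub>v y) = vec 1 (\<lambda>_. a \<bullet> (?R *\<^sub>v y))"
    using a by (intro eq_vecI) auto
  finally have C: "?e \<bullet> (((1/2) \<cdot>\<^sub>m (?A * ?R)) *\<^sub>v y) = t / 2 * (a \<bullet> (?R *\<^sub>v y))"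
    by (simp add: scalar_prod_def)
  have D: "?e \<bullet> (mat 1 1 (\<lambda>_. ?d) *\<^sub>v ?e) = t\<^sup>2 * ?d"
    by (simp add: scalar_prod_def power2_eq_square)
  have cB: "(1/2) \<cdot>\<^sub>m (?R * transpose_mat ?A) \<in> carrier_mat ?m 1"
    and cC: "(1/2) \<cdot>\<^sub>m (?A * ?R) \<in> carrier_mat 1 ?m"
    and cD: "mat 1 1 (\<lambda>_. ?d) \<in> carrier_mat 1 1"
    using R A At by auto
  note Qy = mult_mat_vec_carrier[OF Q y] and By = mult_mat_vec_carrier[OF cB e]
    and Cy = mult_mat_vec_carrier[OF cC y] and Dy = mult_mat_vec_carrier[OF cD e]
  have "(y @\<^sub>v ?e) \<bullet> (lmi_mat n M P c \<alpha> S a b \<sigma> *\<^sub>v (y @\<^sub>v ?e))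
    = y \<bullet> (?Q *\<^sub>v y + ((1/2) \<cdot>\<^sub>m (?R * transpose_mat ?A)) *\<^sub>v ?e)
      + ?e \<bullet> (((1/2) \<cdot>\<^sub>m (?A * ?R)) *\<^sub>v y + mat 1 1 (\<lambda>_. ?d) *\<^sub>v ?e)"
    unfolding lmi_mat_def Let_def four_block_mat_mult_vec[OF Q cB cC cD y e]
    by (rule scalar_prod_append[OF y e add_carrier_vec[OF Qy By] add_carrier_vec[OF Cy Dy]])
  also have "\<dots> = y \<bullet> (?Q *\<^sub>v y) + t * (a \<bullet> (?R *\<^sub>v y)) + t\<^sup>2 * ?d"
    unfolding scalar_prod_add_distrib[OF y Qy By] scalar_prod_add_distrib[OF e Cy Dy] B C D
    by simp
  also have "y \<bullet> (?Q *\<^sub>v y)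
    = (\<Sum>j\<in>S. \<sigma> j * (local_component n M S j y \<bullet> (P j *\<^sub>v local_component n M S j y)))"
    by (rule weighted_P_quadratic_form[OF fin P y])
  finally show ?thesis .
qed

section \<open>Normalizing an ellipsoid to level one\<close>

text \<open>For \<open>\<alpha> = 0\<close> the ellipsoid of a positive definite matrix is the single point \<open>z\<close>.\<close>

lemma ellipsoid_normalized:
  assumes Q: "pos_def_mat m Q" and z: "z \<in> carrier_vec m" and \<alpha>: "0 \<le> \<alpha>"
    and x: "x \<in> ellipsoid m Q z \<alpha>"
  obtains s where "s \<in> carrier_vec m" "x = z + sqrt \<alpha> \<cdot>\<^sub>v s" "s \<bullet> (Q *\<^sub>v s) \<le> 1"
proof (cases "\<alpha> = 0")
  case True
  have xc: "x \<in> carrier_vec m" using x by (simp add: ellipsoid_def)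
  have "x - z = 0\<^sub>v m"
    using Q x z True by (auto simp: ellipsoid_def pos_def_mat_def not_le[symmetric])
  then have "x $ r = z $ r" if "r < m" for r
    using that xc z by (metis carrier_vecD diff_eq_diff_eq diff_self index_minus_vec(1) index_zero_vec(1))
  \<comment> \<open>As \<open>sqrt 0 = 0\<close>, the choice of \<open>s\<close> does not affect the
    point; the zero vector keeps the form below one.\<close>
  then have "x = z + sqrt \<alpha> \<cdot>\<^sub>v 0\<^sub>v m" using xc z by (intro eq_vecI) auto
  moreover have "0\<^sub>v m \<bullet> (Q *\<^sub>v 0\<^sub>v m) \<le> 1"
    using Q by (simp add: pos_def_mat_def scalar_prod_def)
  ultimately show ?thesis using that[of "0\<^sub>v m"] by simp
next
  case False
  have xc: "x \<in> carrier_vec m" and le: "(x - z) \<bullet> (Q *\<^sub>v (x - z)) \<le> \<alpha>"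
    using x by (auto simp: ellipsoid_def)
  have Qc: "Q \<in> carrier_mat m m" using Q by (simp add: pos_def_mat_def)
  \<comment> \<open>Here \<alpha> is positive, and the form picks up the factor
    \<open>1 / sqrt \<alpha>\<close> once from each argument, so the level \<alpha> becomes
    one.\<close>
  let ?s = "(1 / sqrt \<alpha>) \<cdot>\<^sub>v (x - z)"
  have xz: "x - z \<in> carrier_vec m" using xc z by simp
  have "?s \<bullet> (Q *\<^sub>v ?s) = (1 / sqrt \<alpha>) * ((1 / sqrt \<alpha>) * ((x - z) \<bullet> (Q *\<^sub>v (x - z))))"
    unfolding mult_mat_vec[OF Qc xz]
    using mult_mat_vec_carrier[OF Qc xz] xz by simp
  also have "\<dots> = (x - z) \<bullet> (Q *\<^sub>v (x - z)) / \<alpha>" using \<alpha> False by (simp add: field_simps)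
  also have "\<dots> \<le> 1" using le \<alpha> False by (simp add: field_simps)
  finally have "?s \<bullet> (Q *\<^sub>v ?s) \<le> 1" .
  moreover have "x = z + sqrt \<alpha> \<cdot>\<^sub>v ?s" using xc z \<alpha> False by (intro eq_vecI) auto
  moreover have "?s \<in> carrier_vec m" using xz by simp
  ultimately show ?thesis using that by blast
qed

section \<open>The S-procedure for one constraint row\<close>

theorem proposition6:
  fixes M :: nat and n :: "nat \<Rightarrow> nat" and N :: "nat \<Rightarrow> nat set"
    and P :: "nat \<Rightarrow> real mat"
    and q :: "nat \<Rightarrow> nat" and G :: "nat \<Rightarrow> real mat" and g :: "nat \<Rightarrow> real vec"
    and c :: "nat \<Rightarrow> real vec" and \<alpha> :: "nat \<Rightarrow> real"
    and i k :: nat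
  assumes neighbors: "\<And>l. l < M \<Longrightarrow> N l \<subseteq> {..<M} \<and> l \<in> N l"
    and P_pos_def: "\<And>j. j < M \<Longrightarrow> pos_def_mat (n j) (P j)"
    and G_dim: "\<And>l. l < M \<Longrightarrow> G l \<in> carrier_mat (q l) (local_dim n (N l))"
    and g_dim: "\<And>l. l < M \<Longrightarrow> g l \<in> carrier_vec (q l)"
    and origin_interior: "\<And>l. l < M \<Longrightarrow>
      0\<^sub>v (local_dim n (N l)) \<in>
        interior_vec (local_dim n (N l)) (polyhedron (local_dim n (N l)) (G l) (g l))"
    and i: "i < M"
    and k: "k < q i"
    and c_dim: "\<And>j. j < M \<Longrightarrow> c j \<in> carrier_vec (n j)"
    and \<alpha>_nonneg: "\<And>j. j < M \<Longrightarrow> 0 \<le> \<alpha> j"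
    and lmi: "\<exists>\<sigma> :: nat \<Rightarrow> real. (\<forall>j \<in> N i. 0 \<le> \<sigma> j) \<and>
      pos_semidef_mat (local_dim n (N i) + 1)
        (lmi_mat n M P c \<alpha> (N i) (row (G i) k) (g i $ k) \<sigma>)"
  shows "\<forall>x \<in> carrier_vec (local_dim n (N i)).
    (\<forall>j \<in> N i. local_component n M (N i) j x \<in> ellipsoid (n j) (P j) (c j) (\<alpha> j)) \<longrightarrow>
    row (G i) k \<bullet> x \<le> g i $ k"
proof (intro ballI impI)
  fix x assume x: "x \<in> carrier_vec (local_dim n (N i))"
    and ell: "\<forall>j \<in> N i. local_component n M (N i) j x \<in> ellipsoid (n j) (P j) (c j) (\<alpha> j)"
  let ?S = "N i" and ?js = "sorted_list_of_set (N i)" and ?m = "local_dim n (N i)"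
  let ?a = "row (G i) k" and ?b = "g i $ k"
  have S: "?S \<subseteq> {..<M}" using neighbors[OF i] by simp
  then have fin: "finite ?S" using finite_subset by blast
  have dim: "(\<Sum>j\<leftarrow>?js. n j) = ?m"
    using fin by (simp add: local_dim_def sum_list_distinct_conv_sum_set)
  have P: "P j \<in> carrier_mat (n j) (n j)" if "j \<in> ?S" for j
    using P_pos_def[of j] that S by (auto simp: pos_def_mat_def)
  have cS: "c j \<in> carrier_vec (n j)" if "j \<in> ?S" for j using c_dim that S by auto
  have a: "?a \<in> carrier_vec ?m" using G_dim[OF i] k by auto
  \<comment> \<open>With \<open>x\<close> written as a stack, \<open>local_component_stack\<close>
    turns the ellipsoid hypotheses into conditions on the single blocks \<open>y j\<close>.\<close>
  obtain y where y: "\<And>j. y j \<in> carrier_vec (n j)" "x = stack_vecs (map y ?js)"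
    using vec_eq_stack_vecs[of ?js x n] x dim by auto
  have "\<exists>s. s \<in> carrier_vec (n j) \<and> y j = c j + sqrt (\<alpha> j) \<cdot>\<^sub>v s \<and> s \<bullet> (P j *\<^sub>v s) \<le> 1"
    if j: "j \<in> ?S" for j
  proof -
    have "y j \<in> ellipsoid (n j) (P j) (c j) (\<alpha> j)"
      using ell j local_component_stack[where n = n, OF y(1) S j] y(2) by force
    moreover have "j < M" using j S by auto
    ultimately show ?thesis using ellipsoid_normalized[OF P_pos_def c_dim \<alpha>_nonneg] by metis
  qed
  then obtain s where s: "\<And>j. j \<in> ?S \<Longrightarrow> s j \<in> carrier_vec (n j)"
    "\<And>j. j \<in> ?S \<Longrightarrow> y j = c j + sqrt (\<alpha> j) \<cdot>\<^sub>v s j"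
    "\<And>j. j \<in> ?S \<Longrightarrow> s j \<bullet> (P j *\<^sub>v s j) \<le> 1"
    by metis
  let ?v = "stack_vecs (map s ?js)" and ?R = "local_size_sqrt n M \<alpha> ?S"
  have v: "?v \<in> carrier_vec ?m" using dim_stack_map[of ?js s n] s(1) fin dim by simp
  have center: "local_center n M c ?S = stack_vecs (map c ?js)"
    unfolding local_center_def by (rule sel_W_mult[OF c_dim S])
  have Rv: "?R *\<^sub>v ?v = stack_vecs (map (\<lambda>j. sqrt (\<alpha> j) \<cdot>\<^sub>v s j) ?js)"
    unfolding local_size_sqrt_eq[OF S] by (rule local_size_mat_mult_stack[OF S s(1)])
  \<comment> \<open>Reassembling the normalized blocks expresses \<open>x\<close> through the very
    center and root that occur in the matrix inequality.\<close>
  have "local_center n M c ?S + ?R *\<^sub>v ?v = stack_vecs (map (\<lambda>j. c j + sqrt (\<alpha> j) \<cdot>\<^sub>v s j) ?js)"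
    unfolding center Rv by (rule stack_vecs_add) (use cS s(1) fin in auto)
  also have "map (\<lambda>j. c j + sqrt (\<alpha> j) \<cdot>\<^sub>v s j) ?js = map y ?js" using s(2) fin by simp
  finally have x_eq: "x = local_center n M c ?S + ?R *\<^sub>v ?v" using y(2) by simp
  have "local_center n M c ?S \<in> carrier_vec ?m"
    using dim_stack_map[of ?js c n] cS fin dim by (simp add: center)
  moreover have "?R *\<^sub>v ?v \<in> carrier_vec ?m"
    using dim_stack_map[of ?js "\<lambda>j. sqrt (\<alpha> j) \<cdot>\<^sub>v s j" n] s(1) fin dim by (simp add: Rv)
  ultimately have ax: "?a \<bullet> x = ?a \<bullet> local_center n M c ?S + ?a \<bullet> (?R *\<^sub>v ?v)"
    unfolding x_eq by (rule scalar_prod_add_distrib[OF a])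
  obtain \<sigma> where \<sigma>: "\<forall>j \<in> ?S. 0 \<le> \<sigma> j"
    and psd: "pos_semidef_mat (?m + 1) (lmi_mat n M P c \<alpha> ?S ?a ?b \<sigma>)"
    using lmi by blast
  \<comment> \<open>The entry \<open>- 1\<close> gives the cross term the sign needed for an upper
    bound on \<open>?a \<bullet> x\<close>, while its square leaves the corner entry
    unchanged.\<close>
  let ?z = "?v @\<^sub>v vec 1 (\<lambda>_. - 1)"
  have "?z \<in> carrier_vec (?m + 1)" by (rule append_carrier_vec[OF v]) simp
  then have "0 \<le> ?z \<bullet> (lmi_mat n M P c \<alpha> ?S ?a ?b \<sigma> *\<^sub>v ?z)"
    using psd unfolding pos_semidef_mat_def by blast
  also have "\<dots> = (\<Sum>j\<in>?S. \<sigma> j * (s j \<bullet> (P j *\<^sub>v s j))) - ?a \<bullet> (?R *\<^sub>v ?v)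
      + (?b - ?a \<bullet> local_center n M c ?S - (\<Sum>j\<in>?S. \<sigma> j))"
    using local_component_stack[where n = n, OF s(1) S]
    by (subst lmi_mat_quadratic_form[OF S P a v]) simp_all
  \<comment> \<open>Nonnegative multipliers and forms of value at most one bound the weighted sum by
    the sum of the \<sigma>, which cancels against the one subtracted in the corner entry.\<close>
  also have "(\<Sum>j\<in>?S. \<sigma> j * (s j \<bullet> (P j *\<^sub>v s j))) \<le> (\<Sum>j\<in>?S. \<sigma> j)"
    by (rule sum_mono) (use \<sigma> s(3) in \<open>simp add: mult_left_le\<close>)
  finally show "?a \<bullet> x \<le> ?b" using ax by simp
qed

end
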